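(* Assume that for each $n$, $$\mathbb{P}_n\Big[\lVert S_n \rVert_n^2 - \sum_{k=1}^{N_n} \langle S_n, T_n^{(k)} \rangle_n^2 = 0\Big] = 0.$$ Then, for each $n$, almost surely the minimization problem $$\underset{c=(c_0,\dots,c_{N_n}) \in \mathbb{R}^{N_n+1}}{\text{minimize}} \; \Big\lVert c_0 S_n + \sum_{k=1}^{N_n} c_{k} T_n^{(k)} - \Sigma_n \Big\rVert_n^2$$ has as its (unique) solution the coefficients $c^*=(c_0^*,c_1^*,\dots,c_{N_n}^* )$ given by $$c_0^* = \frac{1}{d_n^2}\Big(\langle S_n, \Sigma_n \rangle_n - \sum_{k=1}^{N_n} \langle S_n, T_n^{(k)} \rangle_n\langle \Sigma_n, T_n^{(k)} \rangle_n \Big),$$ $$c_i^* = \langle \Sigma_n, T_n^{(i)} \rangle_n - c_0^* \langle S_n, T_n^{(i)} \rangle_n \quad (1\le i\le N_n),$$ where $d_n^2 = \lVert S_n \rVert_n^2 - \sum_{k=1}^{N_n} \langle S_n, T_n^{(k)} \rangle_n^2$.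
   Context: For each $n\in\mathbb{N}^*$, $X_n$ is a random real $p_n\times n$ matrix whose columns are $n$ i.i.d. observations of a $p_n$-dimensional random vector with covariance matrix $\Sigma_n$; $\mathbb{P}_n$ is the probability associated with the distribution indexed by $n$. Norm: for real $p_n\times p_n$ matrices $A,B$, $\langle A,B\rangle_n=\mathrm{Tr}(AB^T)/p_n$ and $\lVert A\rVert_n=\sqrt{\langle A,A\rangle_n}$. Sample covariance $S_n$: if the mean is known, $S_n=(X_n-\mathbb{E}[X_n])(X_n-\mathbb{E}[X_n])^T/n$; if the mean is unknown, $S_n=\tilde X_n\tilde X_n^T/(n-1)$ (with $n\ge 2$), where $(\tilde X_n)_{ik}=(X_n)_{ik}-\frac1n\sum_{k'=1}^n (X_n)_{ik'}$. The claim holds in each of the two settings. Targets: for each $n$, $T_n^{(1)},\dots,T_n^{(N_n)}$ ($N_n\in\mathbb{N}^*$) are deterministic symmetric $p_n\times p_n$ real matrices, not necessarily positive, orthonormal for $\langle\cdot,\cdot\rangle_n$. *)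

theory Defs
  imports "HOL-Probability.Probability" "Jordan_Normal_Form.Matrix"
begin

unbundle no vec_syntax
hide_const (open) Finite_Cartesian_Product.vec Finite_Cartesian_Product.mat

text \<open>The dimensions vary with the sample size, so vectors and matrices are the types
  \<^typ>\<open>real vec\<close> and \<^typ>\<open>real mat\<close> with explicit carriers; their indices start at 0.\<close>

definition mat_trace :: "real mat \<Rightarrow> real" where
  "mat_trace A = (\<Sum>i<dim_row A. A $$ (i, i))"

definition mat_inner :: "nat \<Rightarrow> real mat \<Rightarrow> real mat \<Rightarrow> real" where
  "mat_inner p A B = mat_trace (A * B\<^sup>T) / real p"

definition mat_norm :: "nat \<Rightarrow> real mat \<Rightarrow> real" where
  "mat_norm p A = sqrt (mat_inner p A A)"

text \<open>The type of matrices has no zero and hence no \<^const>\<open>sum\<close>; this is the sum of a finite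
  family of \<open>p \<times> n\<close> matrices.\<close>

definition mat_sum :: "nat \<Rightarrow> nat \<Rightarrow> ('i \<Rightarrow> real mat) \<Rightarrow> 'i set \<Rightarrow> real mat" where
  "mat_sum p n A I = mat p n (\<lambda>(i, j). \<Sum>k\<in>I. A k $$ (i, j))"

text \<open>The Borel sigma-algebra of \<open>\<real>\<^sup>p\<close>, transported to vectors of dimension \<open>p\<close>
  along their coordinate functions.\<close>

definition vec_borel :: "nat \<Rightarrow> real vec measure" where
  "vec_borel p = vimage_algebra (carrier_vec p) (\<lambda>v. \<lambda>i\<in>{..<p}. v $ i) (\<Pi>\<^sub>M i\<in>{..<p}. borel)"

definition has_covariance_mat :: "'a measure \<Rightarrow> nat \<Rightarrow> ('a \<Rightarrow> real vec) \<Rightarrow> real mat \<Rightarrow> bool" where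
  "has_covariance_mat M p Y \<Sigma> \<longleftrightarrow>
     (\<forall>i<p. integrable M (\<lambda>\<omega>. (Y \<omega> $ i)\<^sup>2)) \<and>
     \<Sigma> = mat p p (\<lambda>(i, j).
       \<integral>\<omega>. (Y \<omega> $ i - (\<integral>\<omega>'. Y \<omega>' $ i \<partial>M)) * (Y \<omega> $ j - (\<integral>\<omega>'. Y \<omega>' $ j \<partial>M)) \<partial>M)"

text \<open>The columns of \<open>X\<close> are \<open>n\<close> independent copies of the random vector \<open>Y\<close>.\<close>

definition iid_columns ::
  "'a measure \<Rightarrow> nat \<Rightarrow> nat \<Rightarrow> ('a \<Rightarrow> real mat) \<Rightarrow> ('a \<Rightarrow> real vec) \<Rightarrow> bool" where
  "iid_columns M p n X Y \<longleftrightarrow>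
     (\<forall>\<omega>\<in>space M. X \<omega> \<in> carrier_mat p n) \<and>
     prob_space.indep_vars M (\<lambda>_. vec_borel p) (\<lambda>k \<omega>. col (X \<omega>) k) {..<n} \<and>
     (\<forall>k<n. distr M (vec_borel p) (\<lambda>\<omega>. col (X \<omega>) k) = distr M (vec_borel p) Y)"

definition expectation_mat :: "'a measure \<Rightarrow> nat \<Rightarrow> nat \<Rightarrow> ('a \<Rightarrow> real mat) \<Rightarrow> real mat" where
  "expectation_mat M p n X = mat p n (\<lambda>(i, k). \<integral>\<omega>. X \<omega> $$ (i, k) \<partial>M)"

definition row_centered :: "nat \<Rightarrow> nat \<Rightarrow> real mat \<Rightarrow> real mat" where
  "row_centered p n A = mat p n (\<lambda>(i, k). A $$ (i, k) - (\<Sum>k'<n. A $$ (i, k')) / real n)"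

datatype mean_setting = Mean_Known | Mean_Unknown

fun min_sample_size :: "mean_setting \<Rightarrow> nat" where
  "min_sample_size Mean_Known = 1"
| "min_sample_size Mean_Unknown = 2"

fun sample_covariance ::
  "mean_setting \<Rightarrow> 'a measure \<Rightarrow> nat \<Rightarrow> nat \<Rightarrow> ('a \<Rightarrow> real mat) \<Rightarrow> 'a \<Rightarrow> real mat" where
  "sample_covariance Mean_Known M p n X \<omega> =
     (let C = X \<omega> - expectation_mat M p n X in (1 / real n) \<cdot>\<^sub>m (C * C\<^sup>T))"
| "sample_covariance Mean_Unknown M p n X \<omega> =
     (let C = row_centered p n (X \<omega>) in (1 / (real n - 1)) \<cdot>\<^sub>m (C * C\<^sup>T))"

end

theory Submission
  imports Defs
begin

text \<open>For a fixed sample the problem is an ordinary least squares problem in the Frobenius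
  inner product: project \<open>\<Sigma>\<close> orthogonally onto the span of \<open>S\<close> and the orthonormal targets.
  Write \<open>s\<^sub>k = \<langle>S, T\<^sub>k\<rangle>\<close> and \<open>\<sigma>\<^sub>k = \<langle>\<Sigma>, T\<^sub>k\<rangle>\<close>. Completing the square, first in each \<open>c\<^sub>k\<close> and
  then in \<open>c\<^sub>0\<close>, turns the objective into
  \<open>const + d\<^sup>2 (c\<^sub>0 - c\<^sub>0\<^sup>*)\<^sup>2 + \<Sum>\<^sub>k (c\<^sub>k + c\<^sub>0 s\<^sub>k - \<sigma>\<^sub>k)\<^sup>2\<close>
  (\<open>sq_mat_norm_combination_minus\<close>). By Bessel's inequality \<open>d\<^sup>2 \<ge> 0\<close>, so wherever \<open>d\<^sup>2 \<noteq> 0\<close> all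
  the squares have positive weight, and \<open>c\<^sup>*\<close> is the only point at which all of them vanish
  (\<open>arg_min_combination\<close>).

  The probabilistic part is that \<open>d\<^sup>2 \<noteq> 0\<close> almost surely. A set has \<^const>\<open>measure\<close> zero
  also when it is not measurable, so the hypothesis on \<open>{d\<^sup>2 = 0}\<close> yields a null set only once
  \<open>d\<^sup>2\<close> is known to be a random variable. It is one, being a polynomial in the
  entries of the observed matrix, which are measurable because its columns are.\<close>

section \<open>The normalised Frobenius inner product\<close>

lemma mat_inner_eq_sum:
  assumes "A \<in> carrier_mat p m" "B \<in> carrier_mat p m"
  shows "mat_inner p A B = (\<Sum>i<p. \<Sum>j<m. A $$ (i, j) * B $$ (i, j)) / real p"
  using assms by (simp add: mat_inner_def mat_trace_def scalar_prod_def atLeast0LessThan)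

lemma mat_inner_commute:
  assumes "A \<in> carrier_mat p m" "B \<in> carrier_mat p m"
  shows "mat_inner p A B = mat_inner p B A"
  using assms by (simp add: mat_inner_eq_sum mult.commute)

lemma mat_inner_add_left:
  assumes "A \<in> carrier_mat p m" "B \<in> carrier_mat p m" "C \<in> carrier_mat p m"
  shows "mat_inner p (A + B) C = mat_inner p A C + mat_inner p B C"
  using assms by (simp add: mat_inner_eq_sum[where m = m] distrib_right sum.distrib add_divide_distrib)

lemma mat_inner_minus_left:
  assumes "A \<in> carrier_mat p m" "B \<in> carrier_mat p m" "C \<in> carrier_mat p m"
  shows "mat_inner p (A - B) C = mat_inner p A C - mat_inner p B C"
  using assms
  by (simp add: minus_carrier_mat mat_inner_eq_sum[where m = m] left_diff_distrib sum_subtractf diff_divide_distrib)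

lemma mat_inner_smult_left:
  assumes "A \<in> carrier_mat p m" "B \<in> carrier_mat p m"
  shows "mat_inner p (a \<cdot>\<^sub>m A) B = a * mat_inner p A B"
  using assms by (simp add: mat_inner_eq_sum[where m = m] sum_distrib_left mult.assoc)

lemma mat_sum_carrier [simp]: "mat_sum p m A I \<in> carrier_mat p m"
  by (simp add: mat_sum_def)

lemma mat_inner_mat_sum_left:
  assumes "\<And>k. k \<in> I \<Longrightarrow> A k \<in> carrier_mat p m" "B \<in> carrier_mat p m"
  shows "mat_inner p (mat_sum p m A I) B = (\<Sum>k\<in>I. mat_inner p (A k) B)"
proof -
  have "mat_inner p (mat_sum p m A I) B =
      (\<Sum>i<p. \<Sum>j<m. \<Sum>k\<in>I. A k $$ (i, j) * B $$ (i, j)) / real p"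
    using assms(2) by (simp add: mat_inner_eq_sum[where m = m] mat_sum_def sum_distrib_right)
  also have "\<dots> = (\<Sum>k\<in>I. \<Sum>i<p. \<Sum>j<m. A k $$ (i, j) * B $$ (i, j)) / real p"
    by (simp add: sum.swap[where B = I])
  also have "\<dots> = (\<Sum>k\<in>I. mat_inner p (A k) B)"
    using assms by (simp add: mat_inner_eq_sum[where m = m] sum_divide_distrib)
  finally show ?thesis .
qed

lemma mat_inner_self_nonneg:
  assumes "A \<in> carrier_mat p m"
  shows "mat_inner p A A \<ge> 0"
  using assms by (auto simp: mat_inner_eq_sum intro!: divide_nonneg_nonneg sum_nonneg)

lemma power2_mat_norm:
  assumes "A \<in> carrier_mat p m"
  shows "(mat_norm p A)\<^sup>2 = mat_inner p A A"
  using mat_inner_self_nonneg[OF assms] by (simp add: mat_norm_def)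

section \<open>Least squares with one free and several orthonormal regressors\<close>

text \<open>Orthonormality leaves no terms \<open>c\<^sub>k c\<^sub>l\<close> with \<open>k \<noteq> l\<close>, so the square can be completed in each
  \<open>c\<^sub>k\<close> separately. Subtracting these squares replaces every inner product of \<open>A\<close> and \<open>B\<close> by that
  of their components orthogonal to the \<open>T k\<close>. Nothing is divided by here, so the identity also
  serves Bessel's inequality, where \<open>d\<close> may be zero.\<close>

lemma sq_mat_norm_combination_targets_squared:
  fixes T :: "'i \<Rightarrow> real mat"
  assumes fin: "finite I"
    and A: "A \<in> carrier_mat p m" and B: "B \<in> carrier_mat p m"
    and T: "\<And>k. k \<in> I \<Longrightarrow> T k \<in> carrier_mat p m"
    and orth: "\<And>k l. k \<in> I \<Longrightarrow> l \<in> I \<Longrightarrow> mat_inner p (T k) (T l) = (if k = l then 1 else 0)"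
  shows "(mat_norm p (a \<cdot>\<^sub>m A + mat_sum p m (\<lambda>k. c k \<cdot>\<^sub>m T k) I - B))\<^sup>2 =
      a\<^sup>2 * ((mat_norm p A)\<^sup>2 - (\<Sum>k\<in>I. (mat_inner p A (T k))\<^sup>2))
      - 2 * a * (mat_inner p A B - (\<Sum>k\<in>I. mat_inner p A (T k) * mat_inner p B (T k)))
      + ((mat_norm p B)\<^sup>2 - (\<Sum>k\<in>I. (mat_inner p B (T k))\<^sup>2))
      + (\<Sum>k\<in>I. (c k + a * mat_inner p A (T k) - mat_inner p B (T k))\<^sup>2)"
proof -
  let ?U = "mat_sum p m (\<lambda>k. c k \<cdot>\<^sub>m T k) I"
  let ?R = "a \<cdot>\<^sub>m A + ?U - B"
  have R: "?R \<in> carrier_mat p m"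
    using B by (rule minus_carrier_mat)
  have left: "mat_inner p ?R C = a * mat_inner p A C + (\<Sum>k\<in>I. c k * mat_inner p (T k) C)
      - mat_inner p B C" if C: "C \<in> carrier_mat p m" for C
    using A B C T
    by (simp add: mat_inner_minus_left[where m = m] mat_inner_add_left[where m = m]
        mat_inner_smult_left[where m = m] mat_inner_mat_sum_left)
  have RT: "mat_inner p (T k) ?R = a * mat_inner p A (T k) + c k - mat_inner p B (T k)"
    if k: "k \<in> I" for k
  proof -
    have "(\<Sum>l\<in>I. c l * mat_inner p (T l) (T k)) = (\<Sum>l\<in>I. if l = k then c l else 0)"
      using k by (intro sum.cong) (auto simp: orth)
    also have "\<dots> = c k"
      using k fin by simp
    finally show ?thesis
      using left[OF T[OF k]] mat_inner_commute[OF T[OF k] R] by simp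
  qed
  have RA: "mat_inner p A ?R = a * mat_inner p A A + (\<Sum>k\<in>I. c k * mat_inner p A (T k))
      - mat_inner p A B"
    using left[OF A] mat_inner_commute[OF A R] mat_inner_commute[OF A B]
    by (simp add: mat_inner_commute[OF A T] cong: sum.cong)
  have RB: "mat_inner p B ?R = a * mat_inner p A B + (\<Sum>k\<in>I. c k * mat_inner p B (T k))
      - mat_inner p B B"
    using left[OF B] mat_inner_commute[OF B R]
    by (simp add: mat_inner_commute[OF B T] cong: sum.cong)
  have "(mat_norm p ?R)\<^sup>2 = a * mat_inner p A ?R + (\<Sum>k\<in>I. c k * mat_inner p (T k) ?R)
      - mat_inner p B ?R"
    using left[OF R] power2_mat_norm[OF R] by simp
  also have "\<dots> = a * mat_inner p A ?R - mat_inner p B ?R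
      + (\<Sum>k\<in>I. c k * (a * mat_inner p A (T k) + c k - mat_inner p B (T k)))"
    by (simp add: RT cong: sum.cong)
  also have "\<dots> = a\<^sup>2 * mat_inner p A A - 2 * a * mat_inner p A B + mat_inner p B B
      + (a * (\<Sum>k\<in>I. c k * mat_inner p A (T k)) - (\<Sum>k\<in>I. c k * mat_inner p B (T k))
      + (\<Sum>k\<in>I. c k * (a * mat_inner p A (T k) + c k - mat_inner p B (T k))))"
    unfolding RA RB by (simp only: power2_eq_square ring_distribs)
  finally have expanded: "(mat_norm p ?R)\<^sup>2 = \<dots>" .
  have "(\<Sum>k\<in>I. (c k + a * mat_inner p A (T k) - mat_inner p B (T k))\<^sup>2) =
      (\<Sum>k\<in>I. a * (c k * mat_inner p A (T k)) - c k * mat_inner p B (T k)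
        + c k * (a * mat_inner p A (T k) + c k - mat_inner p B (T k))
        + a\<^sup>2 * (mat_inner p A (T k))\<^sup>2
        - 2 * a * (mat_inner p A (T k) * mat_inner p B (T k)) + (mat_inner p B (T k))\<^sup>2)"
    by (intro sum.cong refl) (simp add: power2_eq_square algebra_simps)
  then have "(\<Sum>k\<in>I. (c k + a * mat_inner p A (T k) - mat_inner p B (T k))\<^sup>2) =
      a * (\<Sum>k\<in>I. c k * mat_inner p A (T k)) - (\<Sum>k\<in>I. c k * mat_inner p B (T k))
      + (\<Sum>k\<in>I. c k * (a * mat_inner p A (T k) + c k - mat_inner p B (T k)))
      + a\<^sup>2 * (\<Sum>k\<in>I. (mat_inner p A (T k))\<^sup>2)
      - 2 * a * (\<Sum>k\<in>I. mat_inner p A (T k) * mat_inner p B (T k))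
      + (\<Sum>k\<in>I. (mat_inner p B (T k))\<^sup>2)"
    by (simp only: sum.distrib sum_subtractf sum_distrib_left)
  then show ?thesis
    unfolding expanded power2_mat_norm[OF A] power2_mat_norm[OF B] right_diff_distrib
    by linarith
qed

text \<open>The left-hand side is the squared norm of the component of \<open>A\<close> orthogonal to the \<open>T k\<close>,
  that is, the preceding objective at target \<open>0\<close>, \<open>a = 1\<close> and \<open>c k = - \<langle>A, T k\<rangle>\<close>.\<close>

lemma mat_bessel:
  fixes T :: "'i \<Rightarrow> real mat"
  assumes fin: "finite I"
    and A: "A \<in> carrier_mat p m"
    and T: "\<And>k. k \<in> I \<Longrightarrow> T k \<in> carrier_mat p m"
    and orth: "\<And>k l. k \<in> I \<Longrightarrow> l \<in> I \<Longrightarrow> mat_inner p (T k) (T l) = (if k = l then 1 else 0)"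
  shows "(mat_norm p A)\<^sup>2 - (\<Sum>k\<in>I. (mat_inner p A (T k))\<^sup>2) \<ge> 0"
proof -
  have zero: "mat_inner p (0\<^sub>m p m) C = 0" if "C \<in> carrier_mat p m" for C
    using that by (simp add: mat_inner_eq_sum[where m = m])
  have "mat_inner p A (0\<^sub>m p m) = 0"
    using zero[OF A] mat_inner_commute[OF A zero_carrier_mat] by simp
  then have "(mat_norm p A)\<^sup>2 - (\<Sum>k\<in>I. (mat_inner p A (T k))\<^sup>2) =
      (mat_norm p (1 \<cdot>\<^sub>m A + mat_sum p m (\<lambda>k. (- mat_inner p A (T k)) \<cdot>\<^sub>m T k) I - 0\<^sub>m p m))\<^sup>2"
    by (subst sq_mat_norm_combination_targets_squared[OF fin A zero_carrier_mat T orth])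
      (simp_all add: zero T power2_mat_norm[OF zero_carrier_mat])
  then show ?thesis
    by simp
qed

text \<open>With \<open>d \<noteq> 0\<close> the square can be completed in \<open>a\<close> as well, which is where the formula for the
  optimal coefficient \<open>a0\<close> comes from.\<close>

lemma sq_mat_norm_combination_minus:
  fixes T :: "'i \<Rightarrow> real mat"
  assumes fin: "finite I"
    and A: "A \<in> carrier_mat p m" and B: "B \<in> carrier_mat p m"
    and T: "\<And>k. k \<in> I \<Longrightarrow> T k \<in> carrier_mat p m"
    and orth: "\<And>k l. k \<in> I \<Longrightarrow> l \<in> I \<Longrightarrow> mat_inner p (T k) (T l) = (if k = l then 1 else 0)"
    and d_def: "d = (mat_norm p A)\<^sup>2 - (\<Sum>k\<in>I. (mat_inner p A (T k))\<^sup>2)"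
    and d: "d \<noteq> 0"
    and a0_def: "a0 = 1 / d * (mat_inner p A B - (\<Sum>k\<in>I. mat_inner p A (T k) * mat_inner p B (T k)))"
  shows "(mat_norm p (a \<cdot>\<^sub>m A + mat_sum p m (\<lambda>k. c k \<cdot>\<^sub>m T k) I - B))\<^sup>2 =
      ((mat_norm p B)\<^sup>2 - (\<Sum>k\<in>I. (mat_inner p B (T k))\<^sup>2) - d * a0\<^sup>2) + d * (a - a0)\<^sup>2
      + (\<Sum>k\<in>I. (c k + a * mat_inner p A (T k) - mat_inner p B (T k))\<^sup>2)"
proof -
  have "mat_inner p A B - (\<Sum>k\<in>I. mat_inner p A (T k) * mat_inner p B (T k)) = d * a0"
    using d by (simp add: a0_def)
  moreover have "d * (a - a0)\<^sup>2 = a\<^sup>2 * d - 2 * a * (d * a0) + d * a0\<^sup>2"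
    by (simp add: power2_eq_square algebra_simps)
  ultimately show ?thesis
    using sq_mat_norm_combination_targets_squared[OF fin A B T orth, of a c]
    unfolding d_def[symmetric] by simp
qed

text \<open>The weight \<open>d\<close> is positive, so the objective is its constant plus nonnegative terms
  \<open>g c\<close>. They all vanish at the claimed optimum; conversely \<open>g c = 0\<close> forces \<open>c\<^sub>0 = a0\<close>, and then
  each of the remaining squares determines its own coefficient.\<close>

lemma arg_min_combination:
  fixes T :: "nat \<Rightarrow> real mat"
  assumes A: "A \<in> carrier_mat p m" and B: "B \<in> carrier_mat p m"
    and T: "\<And>k. k \<in> {1..N} \<Longrightarrow> T k \<in> carrier_mat p m"
    and orth: "\<And>k l. k \<in> {1..N} \<Longrightarrow> l \<in> {1..N} \<Longrightarrow>
      mat_inner p (T k) (T l) = (if k = l then 1 else 0)"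
    and d_def: "d = (mat_norm p A)\<^sup>2 - (\<Sum>k=1..N. (mat_inner p A (T k))\<^sup>2)"
    and d: "d \<noteq> 0"
    and a0_def: "a0 = 1 / d * (mat_inner p A B - (\<Sum>k=1..N. mat_inner p A (T k) * mat_inner p B (T k)))"
  shows "{c. is_arg_min
            (\<lambda>c. (mat_norm p (c $ 0 \<cdot>\<^sub>m A + mat_sum p m (\<lambda>k. c $ k \<cdot>\<^sub>m T k) {1..N} - B))\<^sup>2)
            (\<lambda>c. c \<in> carrier_vec (N + 1)) c} =
    {vec (N + 1) (\<lambda>i. if i = 0 then a0 else mat_inner p B (T i) - a0 * mat_inner p A (T i))}"
    (is "{c. is_arg_min ?f ?P c} = {?v}")
proof -
  have d_pos: "d > 0"
    using mat_bessel[OF finite_atLeastAtMost A T orth, of 1 N] d unfolding d_def by simp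
  define K where "K = (mat_norm p B)\<^sup>2 - (\<Sum>k=1..N. (mat_inner p B (T k))\<^sup>2) - d * a0\<^sup>2"
  define g where "g c = d * (c $ 0 - a0)\<^sup>2
      + (\<Sum>k=1..N. (c $ k + c $ 0 * mat_inner p A (T k) - mat_inner p B (T k))\<^sup>2)" for c
  have f: "?f c = K + g c" for c :: "real vec"
    unfolding K_def g_def
    by (subst sq_mat_norm_combination_minus[OF finite_atLeastAtMost A B T orth d_def d a0_def])
      simp_all
  have g_nonneg: "g c \<ge> 0" for c
    using d_pos by (auto simp: g_def intro!: add_nonneg_nonneg sum_nonneg)
  have P_v: "?P ?v"
    by simp
  have g_v: "g ?v = 0"
    by (auto simp: g_def intro!: sum.neutral)
  have g_zero: "c = ?v" if c: "?P c" and "g c = 0" for c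
  proof -
    let ?q = "\<lambda>k. (c $ k + c $ 0 * mat_inner p A (T k) - mat_inner p B (T k))\<^sup>2"
    have "d * (c $ 0 - a0)\<^sup>2 \<ge> 0" "(\<Sum>k=1..N. ?q k) \<ge> 0"
      using d_pos by (auto intro: sum_nonneg)
    with \<open>g c = 0\<close> have sq0: "d * (c $ 0 - a0)\<^sup>2 = 0" and sqs: "(\<Sum>k=1..N. ?q k) = 0"
      unfolding g_def by linarith+
    have c0: "c $ 0 = a0"
      using sq0 d by simp
    have "c $ k = mat_inner p B (T k) - a0 * mat_inner p A (T k)" if "k \<in> {1..N}" for k
    proof -
      have "?q k = 0"
        using sqs that by (subst (asm) sum_nonneg_eq_0_iff) auto
      then show ?thesis
        using c0 by simp
    qed
    then show ?thesis
      using c c0 by (intro eq_vecI) auto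
  qed
  show ?thesis
  proof (intro equalityI subsetI)
    fix c assume "c \<in> {c. is_arg_min ?f ?P c}"
    then have c: "?P c" and "\<not> K + g ?v < K + g c"
      using P_v unfolding mem_Collect_eq is_arg_min_def f by blast+
    then have "g c = 0"
      using g_nonneg[of c] g_v by linarith
    then show "c \<in> {?v}"
      using g_zero[OF c] by simp
  next
    fix c assume "c \<in> {?v}"
    then show "c \<in> {c. is_arg_min ?f ?P c}"
      using P_v g_v g_nonneg unfolding mem_Collect_eq is_arg_min_def f
      by (auto simp: not_less)
  qed
qed

section \<open>Measurability of the sample covariance\<close>

lemma measurable_vec_borel_index:
  assumes "i < p"
  shows "(\<lambda>v. v $ i) \<in> borel_measurable (vec_borel p)"
proof -
  have "(\<lambda>v. \<lambda>i\<in>{..<p}. v $ i) \<in> measurable (vec_borel p) (\<Pi>\<^sub>M i\<in>{..<p}. borel)"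
    unfolding vec_borel_def by (rule measurable_vimage_algebra1) (auto simp: space_PiM)
  from measurable_compose[OF this measurable_component_singleton[of i]] assms
  show ?thesis
    by simp
qed

lemma iid_columns_measurable_entry:
  assumes "prob_space M" "iid_columns M p n X Y" "i < p" "k < n"
  shows "(\<lambda>\<omega>. X \<omega> $$ (i, k)) \<in> borel_measurable M"
proof -
  interpret prob_space M by fact
  have "(\<lambda>\<omega>. col (X \<omega>) k) \<in> measurable M (vec_borel p)"
    using assms unfolding iid_columns_def indep_vars_def by blast
  from measurable_compose[OF this measurable_vec_borel_index[OF \<open>i < p\<close>]]
  have "(\<lambda>\<omega>. col (X \<omega>) k $ i) \<in> borel_measurable M" .
  moreover have "col (X \<omega>) k $ i = X \<omega> $$ (i, k)" if "\<omega> \<in> space M" for \<omega>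
    using assms that unfolding iid_columns_def by auto
  ultimately show ?thesis
    by (simp cong: measurable_cong)
qed

lemma sample_covariance_carrier:
  "sample_covariance setting M p n X \<omega> \<in> carrier_mat p p"
  by (rule carrier_matI; cases setting)
    (simp_all add: Let_def expectation_mat_def row_centered_def)

lemma sample_covariance_measurable_entry:
  assumes M: "prob_space M" and X: "iid_columns M p n X Y" and ij: "i < p" "j < p"
  shows "(\<lambda>\<omega>. sample_covariance setting M p n X \<omega> $$ (i, j)) \<in> borel_measurable M"
proof (cases setting)
  case Mean_Known
  let ?E = "expectation_mat M p n X"
  have "sample_covariance setting M p n X \<omega> $$ (i, j) =
      1 / real n * (\<Sum>k<n. (X \<omega> $$ (i, k) - ?E $$ (i, k)) * (X \<omega> $$ (j, k) - ?E $$ (j, k)))"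
    if "\<omega> \<in> space M" for \<omega>
    using ij
    by (simp add: Mean_Known Let_def expectation_mat_def scalar_prod_def atLeast0LessThan)
  moreover have "(\<lambda>\<omega>. 1 / real n *
      (\<Sum>k<n. (X \<omega> $$ (i, k) - ?E $$ (i, k)) * (X \<omega> $$ (j, k) - ?E $$ (j, k))))
      \<in> borel_measurable M"
    by (intro borel_measurable_times borel_measurable_const borel_measurable_sum
        borel_measurable_diff iid_columns_measurable_entry[OF M X] ij) auto
  ultimately show ?thesis
    by (simp cong: measurable_cong)
next
  case Mean_Unknown
  let ?m = "\<lambda>\<omega> i. (\<Sum>k<n. X \<omega> $$ (i, k)) / real n"
  have "sample_covariance setting M p n X \<omega> $$ (i, j) =
      1 / (real n - 1) * (\<Sum>k<n. (X \<omega> $$ (i, k) - ?m \<omega> i) * (X \<omega> $$ (j, k) - ?m \<omega> j))" for \<omega>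
    using ij
    by (simp add: Mean_Unknown Let_def row_centered_def scalar_prod_def atLeast0LessThan)
  moreover have "(\<lambda>\<omega>. 1 / (real n - 1) *
      (\<Sum>k<n. (X \<omega> $$ (i, k) - ?m \<omega> i) * (X \<omega> $$ (j, k) - ?m \<omega> j))) \<in> borel_measurable M"
    by (intro borel_measurable_times borel_measurable_const borel_measurable_sum
        borel_measurable_diff borel_measurable_divide iid_columns_measurable_entry[OF M X] ij) auto
  ultimately show ?thesis
    by simp
qed

lemma borel_measurable_mat_inner:
  assumes "\<And>\<omega>. A \<omega> \<in> carrier_mat p m" "\<And>\<omega>. B \<omega> \<in> carrier_mat p m"
    and "\<And>i j. i < p \<Longrightarrow> j < m \<Longrightarrow> (\<lambda>\<omega>. A \<omega> $$ (i, j)) \<in> borel_measurable M"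
    and "\<And>i j. i < p \<Longrightarrow> j < m \<Longrightarrow> (\<lambda>\<omega>. B \<omega> $$ (i, j)) \<in> borel_measurable M"
  shows "(\<lambda>\<omega>. mat_inner p (A \<omega>) (B \<omega>)) \<in> borel_measurable M"
  unfolding mat_inner_eq_sum[OF assms(1,2)]
  by (intro borel_measurable_divide borel_measurable_sum borel_measurable_times
      borel_measurable_const assms(3,4)) auto

section \<open>Almost sure optimality\<close>

theorem proposition1:
  fixes setting :: mean_setting
    and M :: "nat \<Rightarrow> 'a measure"
    and p N :: "nat \<Rightarrow> nat"
    and X :: "nat \<Rightarrow> 'a \<Rightarrow> real mat"
    and Y :: "nat \<Rightarrow> 'a \<Rightarrow> real vec"
    and \<Sigma> :: "nat \<Rightarrow> real mat"
    and T :: "nat \<Rightarrow> nat \<Rightarrow> real mat"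
    and S :: "nat \<Rightarrow> 'a \<Rightarrow> real mat"
    and d2 :: "nat \<Rightarrow> 'a \<Rightarrow> real"
  assumes prob: "\<And>n. n \<ge> min_sample_size setting \<Longrightarrow> prob_space (M n)"
    and p_pos: "\<And>n. n \<ge> min_sample_size setting \<Longrightarrow> p n \<ge> 1"
    and N_pos: "\<And>n. n \<ge> min_sample_size setting \<Longrightarrow> N n \<ge> 1"
    and Y_meas: "\<And>n. n \<ge> min_sample_size setting \<Longrightarrow> Y n \<in> measurable (M n) (vec_borel (p n))"
    and Y_cov: "\<And>n. n \<ge> min_sample_size setting \<Longrightarrow> has_covariance_mat (M n) (p n) (Y n) (\<Sigma> n)"
    and X_iid: "\<And>n. n \<ge> min_sample_size setting \<Longrightarrow> iid_columns (M n) (p n) n (X n) (Y n)"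
    and T_carrier: "\<And>n k. n \<ge> min_sample_size setting \<Longrightarrow> k \<in> {1..N n} \<Longrightarrow>
           T n k \<in> carrier_mat (p n) (p n)"
    and T_sym: "\<And>n k. n \<ge> min_sample_size setting \<Longrightarrow> k \<in> {1..N n} \<Longrightarrow> (T n k)\<^sup>T = T n k"
    and T_orthonormal: "\<And>n k l. n \<ge> min_sample_size setting \<Longrightarrow> k \<in> {1..N n} \<Longrightarrow> l \<in> {1..N n} \<Longrightarrow>
           mat_inner (p n) (T n k) (T n l) = (if k = l then 1 else 0)"
    and S_eq: "\<And>n \<omega>. S n \<omega> = sample_covariance setting (M n) (p n) n (X n) \<omega>"
    and d2_eq: "\<And>n \<omega>. d2 n \<omega> =
           (mat_norm (p n) (S n \<omega>))\<^sup>2 - (\<Sum>k=1..N n. (mat_inner (p n) (S n \<omega>) (T n k))\<^sup>2)"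
    and nondegenerate: "\<And>n. n \<ge> min_sample_size setting \<Longrightarrow>
           measure (M n) {\<omega> \<in> space (M n). d2 n \<omega> = 0} = 0"
  shows "\<forall>n \<ge> min_sample_size setting. AE \<omega> in M n.
    (let c0 = 1 / d2 n \<omega> * (mat_inner (p n) (S n \<omega>) (\<Sigma> n) -
                (\<Sum>k=1..N n. mat_inner (p n) (S n \<omega>) (T n k) * mat_inner (p n) (\<Sigma> n) (T n k)));
         c_star = vec (N n + 1) (\<lambda>i. if i = 0 then c0
                else mat_inner (p n) (\<Sigma> n) (T n i) - c0 * mat_inner (p n) (S n \<omega>) (T n i))
     in {c. is_arg_min
              (\<lambda>c. (mat_norm (p n)
                 (c $ 0 \<cdot>\<^sub>m S n \<omega> + mat_sum (p n) (p n) (\<lambda>k. c $ k \<cdot>\<^sub>m T n k) {1..N n} - \<Sigma> n))\<^sup>2)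
              (\<lambda>c. c \<in> carrier_vec (N n + 1)) c} = {c_star})"
proof (intro allI impI)
  fix n assume n: "n \<ge> min_sample_size setting"
  interpret prob_space "M n"
    by (rule prob[OF n])
  have S_carrier: "S n \<omega> \<in> carrier_mat (p n) (p n)" for \<omega>
    unfolding S_eq by (rule sample_covariance_carrier)
  have Sigma_carrier: "\<Sigma> n \<in> carrier_mat (p n) (p n)"
    using Y_cov[OF n] by (simp add: has_covariance_mat_def)
  have S_meas: "(\<lambda>\<omega>. S n \<omega> $$ (i, j)) \<in> borel_measurable (M n)" if "i < p n" "j < p n" for i j
    unfolding S_eq
    by (rule sample_covariance_measurable_entry[OF prob_space_axioms X_iid[OF n] that])
  have "d2 n \<in> borel_measurable (M n)"
    unfolding d2_eq power2_mat_norm[OF S_carrier]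
    by (intro borel_measurable_diff borel_measurable_sum borel_measurable_power
        borel_measurable_mat_inner[where m = "p n"] S_carrier S_meas T_carrier[OF n]) auto
  then have "{\<omega> \<in> space (M n). d2 n \<omega> = 0} \<in> events"
    by measurable
  then have "AE \<omega> in M n. d2 n \<omega> \<noteq> 0"
    using nondegenerate[OF n] by (auto simp: prob_eq_0)
  then show "AE \<omega> in M n.
    (let c0 = 1 / d2 n \<omega> * (mat_inner (p n) (S n \<omega>) (\<Sigma> n) -
                (\<Sum>k=1..N n. mat_inner (p n) (S n \<omega>) (T n k) * mat_inner (p n) (\<Sigma> n) (T n k)));
         c_star = vec (N n + 1) (\<lambda>i. if i = 0 then c0
                else mat_inner (p n) (\<Sigma> n) (T n i) - c0 * mat_inner (p n) (S n \<omega>) (T n i))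
     in {c. is_arg_min
              (\<lambda>c. (mat_norm (p n)
                 (c $ 0 \<cdot>\<^sub>m S n \<omega> + mat_sum (p n) (p n) (\<lambda>k. c $ k \<cdot>\<^sub>m T n k) {1..N n} - \<Sigma> n))\<^sup>2)
              (\<lambda>c. c \<in> carrier_vec (N n + 1)) c} = {c_star})"
    unfolding Let_def
    by (rule eventually_mono)
      (rule arg_min_combination[OF S_carrier Sigma_carrier T_carrier[OF n] T_orthonormal[OF n]
          d2_eq _ refl])
qed

end
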